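(* Let $m \geq 2$ and $\epsilon \in \{-1,1\}$. (i) For every integer $n \geq 2$, \[w_{2n+1,2^{m}}^{+}=w_{2n+1,2^{m}}^{-}=\frac{2^{2mn-2n-2m-1}(2^{2n+3}-8)}{3}.\] (ii) For every integer $n \geq 3$, setting for each integer $k\ge 2$ \[D_{k}:=\frac{2^{mk-k-3m}\left(2^{k+1}+8 \times (-1)^{k+1}\right)}{3},\] one has \[\left|\Omega_{2n}^{\epsilon}(m)\right| \geq D_{2n}+2^{m-1}D_{2n-1}+m2^{m-1}D_{2n-4}\] and \[\left|\Omega_{2n}^{\epsilon}(m)\right| \leq D_{2n}+2^{m-1}D_{2n-1}+2^{2m-2}D_{2n-1}.\]
   Context: For a commutative unitary ring $A$ and $a_1,\ldots,a_n\in A$, set \[M_{n}(a_1,\ldots,a_n):=\begin{pmatrix} a_{n} & -1 \\ 1 & 0\end{pmatrix}\begin{pmatrix} a_{n-1} & -1 \\ 1 & 0\end{pmatrix}\cdots\begin{pmatrix} a_{1} & -1 \\ 1 & 0\end{pmatrix}.\] For $m\ge 2$, $n\ge 2$ and $\epsilon\in\{-1,1\}$, let $\Omega_{n}^{\epsilon}(m):=\{(a_{1},\ldots,a_{n}) \in (\mathbb{Z}/2^{m}\mathbb{Z})^{n}:~M_{n}(a_{1},\ldots,a_{n})=\epsilon Id\}$, $w_{n,2^{m}}^{+}:=|\Omega_{n}^{1}(m)|$ and $w_{n,2^{m}}^{-}:=|\Omega_{n}^{-1}(m)|$. *)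

theory Defs
  imports "HOL-Analysis.Analysis" "Berlekamp_Zassenhaus.Finite_Field"
begin

definition elem_mat :: "'a::comm_ring_1 \<Rightarrow> 'a ^ 2 ^ 2" where
  "elem_mat a = vector [vector [a, -1], vector [1, 0]]"

text \<open>The tuple \<open>(a\<^sub>1, \<dots>, a\<^sub>n)\<close> is the list \<open>[a\<^sub>1, \<dots>, a\<^sub>n]\<close>; the matrix of
  \<open>a\<^sub>1\<close> is the rightmost factor.\<close>

primrec M :: "'a::comm_ring_1 list \<Rightarrow> 'a ^ 2 ^ 2" where
  "M [] = mat 1"
| "M (a # as) = M as ** elem_mat a"

text \<open>The ring is given by the type: \<open>\<int>/2\<^sup>m\<int>\<close> is \<open>'b mod_ring\<close> with \<open>CARD('b) = 2 ^ m\<close>.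
  The scalar matrix \<open>\<epsilon> Id\<close> is \<open>mat (of_int \<epsilon>)\<close>.\<close>

definition \<Omega> :: "int \<Rightarrow> nat \<Rightarrow> 'a::comm_ring_1 list set" where
  "\<Omega> \<epsilon> n = {as. length as = n \<and> M as = mat (of_int \<epsilon>)}"

text \<open>The exponent \<open>m k - k - 3 m\<close> is negative for small \<open>k\<close>, hence \<open>powi\<close>.\<close>

definition D :: "nat \<Rightarrow> nat \<Rightarrow> real" where
  "D m k = 2 powi (int m * int k - int k - 3 * int m) * (2 ^ (k + 1) + 8 * (-1) ^ (k + 1)) / 3"

end

theory Submission
  imports Defs
begin

text \<open>
  If \<open>M (x # y # as) = \<epsilon> Id\<close>, then the continuant \<open>K as\<close> (the upper left entry of \<open>M as\<close>) equals \<open>-\<epsilon>\<close>,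
  and conversely any \<open>as\<close> with \<open>K as = -\<epsilon>\<close> determines \<open>x\<close> and \<open>y\<close>; so the task is to count
  the lists whose continuant takes a given unit value.

  In \<open>\<int>/2\<^sup>m\<int>\<close> there are \<open>h = 2\<^bsup>m-1\<^esup>\<close> units and as many nonunits, and the lists of length \<open>k\<close> whose
  continuant is a unit satisfy a linear recurrence in \<open>k\<close>; their number is \<open>D\<^bsub>k+3\<^esub>\<close>. For odd \<open>k\<close>, multiplying the
  entries alternately by \<open>s\<close> and \<open>s\<inverse>\<close> multiplies the continuant by \<open>s\<close>, so all unit values are
  taken equally often. For even \<open>k\<close>, write \<open>K (a # b # as) = a * K (b # as) - K as\<close>: the lists with
  \<open>K (b # as)\<close> a unit, and those with \<open>a\<close> but not \<open>K (b # as)\<close> a unit, are counted exactly by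
  solving for the remaining variable. When both factors are nonunits, the triple \<open>(a, K (b # as), as)\<close>
  determines the list, and conversely both factors can be prescribed freely as soon as the
  continuant of the tail of \<open>as\<close> is a unit.
\<close>

section \<open>Continuants\<close>

abbreviation K :: "'a::comm_ring_1 list \<Rightarrow> 'a" where
  "K as \<equiv> M as $ 1 $ 1"

abbreviation L :: "'a::comm_ring_1 list \<Rightarrow> 'a" where
  "L as \<equiv> M as $ 1 $ 2"

lemma K_Nil [simp]: "K [] = 1" and L_Nil [simp]: "L [] = 0"
  by (simp_all add: mat_def)

lemma M_Cons_entries:
  "K (a # as) = a * K as + L as"
  "L (a # as) = - K as"
  "M (a # as) $ 2 $ 1 = a * (M as $ 2 $ 1) + M as $ 2 $ 2"
  "M (a # as) $ 2 $ 2 = - (M as $ 2 $ 1)"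
  by (simp_all add: matrix_matrix_mult_def elem_mat_def sum_2 mult.commute)

text \<open>Every factor \<open>elem_mat a\<close> has determinant 1.\<close>

lemma M_det: "K as * (M as $ 2 $ 2) - L as * (M as $ 2 $ 1) = 1"
proof (induction as)
  case Nil
  show ?case by (simp add: mat_def)
next
  case (Cons a as)
  then show ?case by (simp only: M_Cons_entries) (simp add: algebra_simps)
qed

declare M.simps [simp del]

section \<open>From scalar matrix equations to continuants\<close>

lemma mat_2_eq_iff:
  fixes A :: "'a::zero ^ 2 ^ 2"
  shows "A = mat c \<longleftrightarrow> A $ 1 $ 1 = c \<and> A $ 1 $ 2 = 0 \<and> A $ 2 $ 1 = 0 \<and> A $ 2 $ 2 = c"
  by (auto simp: vec_eq_iff forall_2 mat_def)

text \<open>Equivalently, \<open>M as\<close> is \<open>e\<close> times the inverse of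
  \<open>elem_mat y ** elem_mat x\<close>, which has rows (-1, y) and (-x, x y - 1). Three entries
  give the right-hand side; the fourth is then forced by the determinant.\<close>

lemma M_Cons_Cons_eq_scalar_iff:
  fixes e :: "'a::comm_ring_1"
  assumes e: "e * e = 1"
  shows "M (x # y # as) = mat e \<longleftrightarrow> K as = - e \<and> x = - (e * (M as $ 2 $ 1)) \<and> y = e * L as"
    (is "?lhs \<longleftrightarrow> ?rhs")
proof
  assume ?lhs
  then have entries: "K (x # y # as) = e" "L (x # y # as) = 0"
    "M (x # y # as) $ 2 $ 1 = 0" "M (x # y # as) $ 2 $ 2 = e"
    by (simp_all add: mat_2_eq_iff)
  from entries(2) have 2: "K (y # as) = 0" by (simp add: M_Cons_entries(2))
  with entries(1) have K: "K as = - e"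
    unfolding M_Cons_entries(1)[of x] M_Cons_entries(2)[of y] by (simp flip: minus_equation_iff)
  from entries(4) have "M (y # as) $ 2 $ 1 = - e" by (simp add: M_Cons_entries(4)[of x] flip: minus_equation_iff)
  with entries(3) have c: "M as $ 2 $ 1 = - (e * x)"
    unfolding M_Cons_entries(3)[of x] M_Cons_entries(4)[of y] by (simp add: mult.commute eq_neg_iff_add_eq_0)
  from 2 K have l: "L as = e * y" by (simp add: M_Cons_entries mult.commute)
  have "e * (e * x) = x" "e * (e * y) = y" using e by (simp_all flip: mult.assoc)
  then show ?rhs using K c l by simp
next
  assume r: ?rhs
  from M_det[of as] r have d: "- e * (M as $ 2 $ 2) - L as * (M as $ 2 $ 1) = 1" by simp
  \<comment> \<open>The last bracket is the determinant \<open>d\<close>, and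
    \<open>1 - e * e\<close> vanishes.\<close>
  have "y * (M as $ 2 $ 1) + M as $ 2 $ 2
      = (1 - e * e) * (M as $ 2 $ 2) - e * (- e * (M as $ 2 $ 2) - L as * (M as $ 2 $ 1)) + 0"
    using r by (simp add: algebra_simps)
  with d e have 4: "y * (M as $ 2 $ 1) + M as $ 2 $ 2 = - e" by simp
  have 2: "y * K as + L as = 0"
  proof -
    have "y * K as + L as = - (e * e) * L as + L as" using r by (simp add: algebra_simps)
    then show ?thesis using e by simp
  qed
  have 3: "x * (- e) - M as $ 2 $ 1 = 0"
  proof -
    have "x * (- e) - M as $ 2 $ 1 = (e * e) * (M as $ 2 $ 1) - M as $ 2 $ 1" using r by (simp add: algebra_simps)
    then show ?thesis using e by simp
  qed
  show ?lhs using r 2 3 4 by (simp add: mat_2_eq_iff M_Cons_entries)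
qed

lemma card_\<Omega>_eq_card_K:
  fixes \<epsilon> :: int
  assumes "\<epsilon> \<in> {-1, 1}"
  shows "card (\<Omega> \<epsilon> (Suc (Suc n)) :: 'a::comm_ring_1 list set)
    = card {as :: 'a list. length as = n \<and> K as = of_int (- \<epsilon>)}" (is "card ?A = card ?B")
proof -
  let ?e = "of_int \<epsilon> :: 'a"
  have e: "?e * ?e = 1" using assms by auto
  have "bij_betw (\<lambda>as. - (?e * (M as $ 2 $ 1)) # (?e * L as) # as) ?B ?A"
  proof (intro bij_betwI')
    fix l assume "l \<in> ?A"
    then obtain x y as where "l = x # y # as" "length as = n" "M (x # y # as) = mat ?e"
      by (auto simp: \<Omega>_def length_Suc_conv)
    then show "\<exists>as\<in>?B. l = - (?e * (M as $ 2 $ 1)) # (?e * L as) # as"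
      unfolding M_Cons_Cons_eq_scalar_iff[OF e] by auto
  qed (auto simp: \<Omega>_def M_Cons_Cons_eq_scalar_iff[OF e])
  then show ?thesis by (simp add: bij_betw_same_card)
qed

section \<open>Alternating rescaling of the entries\<close>

primrec alternate_scale :: "'a::comm_ring_1 \<Rightarrow> 'a \<Rightarrow> 'a list \<Rightarrow> 'a list" where
  "alternate_scale s t [] = []"
| "alternate_scale s t (a # as) = s * a # alternate_scale t s as"

lemma length_alternate_scale [simp]: "length (alternate_scale s t as) = length as"
  by (induction as arbitrary: s t) auto

lemma alternate_scale_inverse:
  assumes "s * t = 1"
  shows "alternate_scale s t (alternate_scale t s as) = as"
  using assms
proof (induction as arbitrary: s t)
  case (Cons a as)
  from Cons.prems have ts: "t * s = 1" by (simp add: mult.commute)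
  show ?case using Cons.IH[OF ts] Cons.prems by (simp flip: mult.assoc)
qed simp

text \<open>\<open>elem_mat (s * a)\<close> is diag(s, 1) \<open>elem_mat a\<close> diag(1, t), and
  \<open>elem_mat (t * a)\<close> is diag(1, s) \<open>elem_mat a\<close> diag(t, 1). In the
  alternating product the inner diagonal factors cancel; parity decides the outer left one.
  \<open>K\<close> and \<open>L\<close> go together because their recursions are coupled.\<close>

lemma M_alternate_scale:
  assumes "s * t = 1"
  shows "K (alternate_scale s t as) = (if even (length as) then K as else s * K as) \<and>
    L (alternate_scale s t as) = (if even (length as) then t * L as else L as)"
  using assms
proof (induction as arbitrary: s t)
  case (Cons a as)
  from Cons.prems have ts: "t * s = 1" by (simp add: mult.commute)
  have "s * a * (t * K as) = a * K as"
    using Cons.prems by (metis mult.assoc mult.commute mult_1_left)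
  then show ?case using Cons.IH[OF ts] by (auto simp: M_Cons_entries algebra_simps)
qed simp

lemma card_K_odd_length_eq:
  fixes c d :: "'a::comm_ring_1"
  assumes "odd n" "c dvd 1" "d dvd 1"
  shows "card {as. length as = n \<and> K as = c} = card {as. length as = n \<and> K as = d}"
proof -
  obtain c' d' where c': "c * c' = 1" and d': "d * d' = 1"
    using assms by (metis dvdE)
  \<comment> \<open>\<open>s\<close> is the quotient d / c and \<open>t\<close> its inverse;
    exchanging them inverts the rescaling.\<close>
  define s t where "s = d * c'" and "t = c * d'"
  have st: "s * t = 1" and ts: "t * s = 1" and sc: "s * c = d" and td: "t * d = c"
    using c' d' unfolding s_def t_def by (metis mult.assoc mult.commute mult_1_right)+
  have "bij_betw (alternate_scale s t) {as. length as = n \<and> K as = c} {as. length as = n \<and> K as = d}"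
    by (rule bij_betw_byWitness[where f' = "alternate_scale t s"])
      (use assms(1) sc td in \<open>auto simp: alternate_scale_inverse[OF st] alternate_scale_inverse[OF ts]
         M_alternate_scale[OF st] M_alternate_scale[OF ts]\<close>)
  then show ?thesis by (rule bij_betw_same_card)
qed

section \<open>Finite local rings with residue field of two elements\<close>

lemma is_unit_mult_iff_comm_ring:
  fixes x y :: "'a::comm_ring_1"
  shows "x * y dvd 1 \<longleftrightarrow> x dvd 1 \<and> y dvd 1"
  by (metis dvd_mult_left dvd_mult_right mult_dvd_mono mult_1_left)

lemma unit_mult_cancel:
  fixes k :: "'a::comm_ring_1"
  assumes "k dvd 1" "a * k = b * k"
  shows "a = b"
  using assms by (metis dvdE mult.assoc mult_1_right)

lemma K_Cons_inject:
  fixes as :: "'a::comm_ring_1 list"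
  assumes "K as dvd 1" "K (a # as) = K (b # as)"
  shows "a = b"
  using assms(2) unfolding M_Cons_entries(1) add_right_cancel by (rule unit_mult_cancel[OF assms(1)])

lemma unit_linear_solve:
  fixes k :: "'a::comm_ring_1"
  assumes "k dvd 1"
  obtains a where "a * k + l = c"
proof -
  obtain k' where "1 = k * k'" using assms by (rule dvdE)
  then have "(c - l) * k' * k + l = c" by (metis diff_add_cancel mult.assoc mult.commute mult_1_right)
  then show ?thesis by (rule that)
qed

text \<open>The condition says that \<open>x \<mapsto> (x is a unit)\<close> is additive modulo 2; this characterises local
  rings whose residue field has two elements.\<close>

locale binary_local_ring =
  fixes ring_type :: "'a::{comm_ring_1, finite} itself"
  assumes is_unit_add_iff: "\<And>x y :: 'a. x + y dvd 1 \<longleftrightarrow> (x dvd 1 \<longleftrightarrow> \<not> y dvd 1)"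
begin

abbreviation Units :: "'a set" where "Units \<equiv> {x. x dvd 1}"
abbreviation Nonunits :: "'a set" where "Nonunits \<equiv> {x. \<not> x dvd 1}"

definition h :: nat where "h = card Nonunits"

definition unit_K :: "nat \<Rightarrow> 'a list set" where
  "unit_K n = {as. length as = n \<and> K as dvd 1}"

lemma finite_length_K [simp]: "finite {as :: 'a list. length as = n \<and> Q as}"
  by (rule finite_subset[OF _ finite_lists_length_eq[OF finite, of UNIV n]]) auto

lemma finite_unit_K [simp]: "finite (unit_K n)"
  by (simp add: unit_K_def)

text \<open>Adding the unit 1 exchanges units and nonunits.\<close>

lemma card_Units: "card Units = h"
proof -
  have "bij_betw (\<lambda>x. x + 1) Nonunits Units"
    by (rule bij_betw_byWitness[where f' = "\<lambda>x. x - 1"])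
      (auto simp: is_unit_add_iff is_unit_add_iff[of _ "-1", simplified])
  then show ?thesis unfolding h_def by (metis bij_betw_same_card)
qed

lemma card_ring: "CARD('a) = 2 * h"
proof -
  have "CARD('a) = card (Units \<union> Nonunits)" by (rule arg_cong[where f = card]) auto
  also have "\<dots> = card Units + card Nonunits" by (rule card_Un_disjoint) auto
  finally show ?thesis by (simp add: card_Units h_def)
qed

lemma h_pos: "h > 0"
  using card_ring zero_less_card_finite[where 'a='a] by simp

lemma is_unit_diff_iff: "x - y dvd 1 \<longleftrightarrow> (x dvd 1 \<longleftrightarrow> \<not> y dvd 1)" for x y :: 'a
  using is_unit_add_iff[of x "- y"] by simp

text \<open>Otherwise the determinant 1 would be a difference of two nonunits.\<close>

lemma K_or_L_unit: "K as dvd 1 \<or> L as dvd 1" for as :: "'a list"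
proof -
  have "K as * (M as $ 2 $ 2) - L as * (M as $ 2 $ 1) dvd 1" by (simp add: M_det)
  then show ?thesis by (auto simp: is_unit_diff_iff is_unit_mult_iff_comm_ring)
qed

text \<open>If \<open>K (a # as)\<close> is a nonunit, then \<open>K as\<close> is a unit: otherwise
  \<open>L as\<close> would be a unit and \<open>a * K as\<close> a nonunit. So a list with nonunit
  continuant corresponds to a free choice of that value and of a tail in
  \<open>unit_K n\<close>.\<close>

lemma card_unit_K_Suc: "card (unit_K (Suc n)) + h * card (unit_K n) = (2 * h) ^ Suc n"
proof -
  let ?N = "{as :: 'a list. length as = Suc n \<and> \<not> K as dvd 1}"
  have K_tl: "K as dvd 1" if "\<not> K (a # as) dvd 1" for a :: 'a and as
    using that K_or_L_unit[of as] by (auto simp: M_Cons_entries is_unit_add_iff is_unit_mult_iff_comm_ring)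
  have "bij_betw (\<lambda>l. (K l, tl l)) ?N (Nonunits \<times> unit_K n)"
  proof (intro bij_betwI')
    fix l l' assume l: "l \<in> ?N" and l': "l' \<in> ?N"
    then obtain a as b bs where ll: "l = a # as" "l' = b # bs" by (auto simp: length_Suc_conv)
    then have "K as dvd 1" using l by (intro K_tl[of a]) simp
    then show "((K l, tl l) = (K l', tl l')) = (l = l')"
      unfolding ll using K_Cons_inject[of as a b] by auto
  next
    fix l assume "l \<in> ?N"
    then show "(K l, tl l) \<in> Nonunits \<times> unit_K n"
      by (auto simp: length_Suc_conv unit_K_def dest: K_tl)
  next
    fix p assume p: "p \<in> Nonunits \<times> unit_K n"
    then obtain c as where p: "p = (c, as)" "\<not> c dvd 1" "length as = n" "K as dvd 1"
      by (auto simp: unit_K_def)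
    obtain a where "a * K as + L as = c" using unit_linear_solve[OF p(4)] .
    then show "\<exists>l\<in>?N. p = (K l, tl l)"
      using p by (intro bexI[of _ "a # as"]) (auto simp: M_Cons_entries)
  qed
  then have "card ?N = h * card (unit_K n)"
    by (simp add: bij_betw_same_card card_cartesian_product h_def)
  moreover have "card (unit_K (Suc n)) + card ?N = card {as :: 'a list. length as = Suc n}"
    unfolding unit_K_def by (subst card_Un_disjoint[symmetric]) (auto intro: arg_cong[where f = card])
  moreover have "card {as :: 'a list. length as = Suc n} = (2 * h) ^ Suc n"
    using card_lists_length_eq[of "UNIV :: 'a set" "Suc n"] by (simp add: card_ring)
  ultimately show ?thesis by simp
qed

text \<open>Divided by h^n, the recurrence becomes u(n+1) + u(n) = 2^(n+1) with u(0) = 1.\<close>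

lemma card_unit_K: "real (card (unit_K n)) = real h ^ n * (2 ^ (n + 1) + (-1) ^ n) / 3"
proof (induction n)
  case 0
  have "unit_K 0 = {[]}" by (auto simp: unit_K_def)
  then show ?case by simp
next
  case (Suc n)
  have "real (card (unit_K (Suc n))) = (2 * real h) ^ Suc n - real h * real (card (unit_K n))"
    using arg_cong[OF card_unit_K_Suc[of n], of real] by simp
  then show ?case unfolding Suc.IH by (simp add: field_simps power_mult_distrib)
qed

lemma h_mult_card_K_odd_length:
  assumes "odd n" "c dvd 1"
  shows "h * card {as :: 'a list. length as = n \<and> K as = c} = card (unit_K n)"
proof -
  have "unit_K n = (\<Union>d\<in>Units. {as. length as = n \<and> K as = d})"
    by (auto simp: unit_K_def)
  then have "card (unit_K n) = (\<Sum>d\<in>Units. card {as :: 'a list. length as = n \<and> K as = d})"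
    by (simp only:) (rule card_UN_disjoint, auto)
  also have "\<dots> = (\<Sum>d\<in>Units. card {as :: 'a list. length as = n \<and> K as = c})"
    using assms by (intro sum.cong card_K_odd_length_eq) auto
  finally show ?thesis by (simp add: card_Units)
qed

section \<open>Solutions in which both leading factors are nonunits\<close>

definition nonunit_solutions :: "nat \<Rightarrow> 'a \<Rightarrow> 'a list set" where
  "nonunit_solutions n c = {a # b # as | a b as. length as = n \<and> \<not> a dvd 1 \<and> \<not> K (b # as) dvd 1
     \<and> K (a # b # as) = c}"

text \<open>In \<open>a * K (b # as) - K as\<close> the product is a nonunit, so only
  \<open>K as\<close> can make the difference a unit.\<close>

lemma K_tl_tl_unit:
  fixes as :: "'a list"
  assumes "K (a # b # as) dvd 1" "\<not> K (b # as) dvd 1"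
  shows "K as dvd 1"
  using assms unfolding M_Cons_entries(1)[of a] M_Cons_entries(2)[of b]
  by (auto simp: is_unit_diff_iff is_unit_mult_iff_comm_ring)

lemma nonunit_solutionsE:
  assumes "l \<in> nonunit_solutions n c" "c dvd 1"
  obtains a b as where "l = a # b # as" "length as = n" "\<not> a dvd 1" "\<not> K (b # as) dvd 1"
    "K as dvd 1"
proof -
  from assms(1) obtain a b as where l: "l = a # b # as" "length as = n" "\<not> a dvd 1"
    "\<not> K (b # as) dvd 1" "K (a # b # as) = c"
    unfolding nonunit_solutions_def mem_Collect_eq by (elim exE conjE) (rule that)
  then have "K as dvd 1" using assms(2) by (intro K_tl_tl_unit[of a b as]) simp_all
  with l(1-4) show ?thesis by (rule that)
qed

lemma finite_nonunit_solutions [simp]: "finite (nonunit_solutions n c)"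
  by (rule finite_subset[OF _ finite_length_K[of "Suc (Suc n)" "\<lambda>_. True"]])
    (auto simp: nonunit_solutions_def)

lemma card_K_eq:
  assumes c: "c dvd 1"
  shows "card {as :: 'a list. length as = Suc (Suc n) \<and> K as = c}
    = card (unit_K (Suc n)) + h * card (unit_K n) + card (nonunit_solutions n c)"
proof -
  let ?S = "{as :: 'a list. length as = Suc (Suc n) \<and> K as = c}"
  let ?A = "{l \<in> ?S. K (tl l) dvd 1}"
  let ?B = "{l \<in> ?S. \<not> K (tl l) dvd 1 \<and> hd l dvd 1}"
  have C: "nonunit_solutions n c = {l \<in> ?S. \<not> K (tl l) dvd 1 \<and> \<not> hd l dvd 1}"
    by (auto simp: nonunit_solutions_def length_Suc_conv)
  \<comment> \<open>When the continuant of the tail is a unit, the tail determines the first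
    entry.\<close>
  have "bij_betw tl ?A (unit_K (Suc n))"
  proof (intro bij_betwI')
    fix l l' assume "l \<in> ?A" "l' \<in> ?A"
    then obtain a as b bs where ll: "l = a # as" "l' = b # bs" "K as dvd 1"
      "K (a # as) = c" "K (b # bs) = c"
      by (auto simp: length_Suc_conv)
    have "a = b" if "as = bs"
      using K_Cons_inject[OF ll(3), of a b] ll(4,5) unfolding that by simp
    then show "(tl l = tl l') = (l = l')" unfolding ll(1,2) by auto
  next
    fix as assume "as \<in> unit_K (Suc n)"
    then have as: "length as = Suc n" "K as dvd 1" by (auto simp: unit_K_def)
    obtain a where "a * K as + L as = c" using unit_linear_solve[OF as(2)] .
    then show "\<exists>l\<in>?A. as = tl l" using as by (intro bexI[of _ "a # as"]) (auto simp: M_Cons_entries)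
  qed (auto simp: unit_K_def)
  then have A: "card ?A = card (unit_K (Suc n))" by (rule bij_betw_same_card)
  \<comment> \<open>With \<open>a\<close> a unit, the equation yields \<open>K (b # as)\<close>,
    which in turn yields \<open>b\<close> because \<open>K as\<close> is a unit.\<close>
  have "bij_betw (\<lambda>l. (hd l, tl (tl l))) ?B (Units \<times> unit_K n)"
  proof (intro bij_betwI')
    fix l l' assume l: "l \<in> ?B" and l': "l' \<in> ?B"
    then obtain a b as a' b' as' where ll: "l = a # b # as" "l' = a' # b' # as'"
      by (auto simp: length_Suc_conv)
    have ua: "a dvd 1" and eqs: "a * K (b # as) - K as = c" "a' * K (b' # as') - K as' = c"
      using l l' ll by (simp_all add: M_Cons_entries)
    have uK: "K as dvd 1" using l ll c by (auto intro: K_tl_tl_unit)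
    show "((hd l, tl (tl l)) = (hd l', tl (tl l'))) = (l = l')"
    proof
      assume "(hd l, tl (tl l)) = (hd l', tl (tl l'))"
      then have [simp]: "a' = a" "as' = as" using ll by auto
      have "K (b # as) * a = K (b' # as) * a" using eqs by (simp add: algebra_simps)
      then have "K (b # as) = K (b' # as)" by (rule unit_mult_cancel[OF ua])
      then have "b = b'" by (rule K_Cons_inject[OF uK])
      then show "l = l'" using ll by simp
    qed simp
  next
    fix l assume "l \<in> ?B"
    then show "(hd l, tl (tl l)) \<in> Units \<times> unit_K n"
      using c by (auto simp: unit_K_def length_Suc_conv intro: K_tl_tl_unit)
  next
    fix p assume "p \<in> Units \<times> unit_K n"
    then obtain a as where p: "p = (a, as)" "a dvd 1" "length as = n" "K as dvd 1"
      by (auto simp: unit_K_def)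
    obtain y where y: "y * a + 0 = c + K as" using unit_linear_solve[OF p(2)] .
    \<comment> \<open>\<open>c\<close> and \<open>K as\<close> are units, so their sum is a nonunit;
      hence \<open>y\<close> is a nonunit, as membership in \<open>?B\<close> demands.\<close>
    then have "y * a dvd 1 \<longleftrightarrow> False" using c p by (simp add: is_unit_add_iff)
    then have ny: "\<not> y dvd 1" using p by (simp add: is_unit_mult_iff_comm_ring)
    obtain b where b: "b * K as + L as = y" using unit_linear_solve[OF p(4)] .
    then show "\<exists>l\<in>?B. p = (hd l, tl (tl l))"
      using p ny y by (intro bexI[of _ "a # b # as"]) (auto simp: M_Cons_entries mult.commute)
  qed
  then have B: "card ?B = h * card (unit_K n)"
    by (simp add: bij_betw_same_card card_cartesian_product card_Units)
  have "?S = ?A \<union> (?B \<union> nonunit_solutions n c)" unfolding C by auto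
  then have "card ?S = card (?A \<union> (?B \<union> nonunit_solutions n c))" by (rule arg_cong)
  also have "\<dots> = card ?A + (card ?B + card (nonunit_solutions n c))"
    unfolding C by (subst card_Un_disjoint; (subst card_Un_disjoint)?) auto
  finally show ?thesis using A B by simp
qed

text \<open>The two nonunits and the remaining tail determine \<open>b\<close>, since
  \<open>K as\<close> is a unit. The bound counts all such triples, whether or not they solve the
  equation.\<close>

lemma card_nonunit_solutions_le:
  assumes c: "c dvd 1"
  shows "card (nonunit_solutions n c) \<le> h\<^sup>2 * card (unit_K n)"
proof -
  let ?f = "\<lambda>l. (hd l, K (tl l), tl (tl l))"
  have "inj_on ?f (nonunit_solutions n c)"
  proof (rule inj_onI)
    fix l l' assume l: "l \<in> nonunit_solutions n c" and l': "l' \<in> nonunit_solutions n c"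
      and eq: "?f l = ?f l'"
    from l c obtain a b as where ll: "l = a # b # as" "K as dvd 1"
      by (rule nonunit_solutionsE)
    from l' c obtain a' b' as' where ll': "l' = a' # b' # as'"
      by (rule nonunit_solutionsE)
    have eqs: "a' = a" "as' = as" using eq unfolding ll ll' by simp_all
    have "K (b # as) = K (b' # as)" using eq unfolding ll ll' eqs by simp
    then have "b = b'" by (rule K_Cons_inject[OF ll(2)])
    then show "l = l'" unfolding ll ll' eqs by simp
  qed
  moreover have "?f ` nonunit_solutions n c \<subseteq> Nonunits \<times> Nonunits \<times> unit_K n"
  proof
    fix p assume "p \<in> ?f ` nonunit_solutions n c"
    then obtain l where l: "l \<in> nonunit_solutions n c" and p: "p = ?f l" by (rule imageE)
    show "p \<in> Nonunits \<times> Nonunits \<times> unit_K n"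
      using l c by (rule nonunit_solutionsE) (simp add: p unit_K_def)
  qed
  ultimately have "card (nonunit_solutions n c) \<le> card (Nonunits \<times> Nonunits \<times> unit_K n)"
    by (rule card_inj_on_le) simp
  then show ?thesis by (simp add: card_cartesian_product h_def power2_eq_square)
qed

text \<open>The additional entry \<open>e\<close> makes every triple attainable: it is tuned so that
  the equation holds for the prescribed nonunits.\<close>

lemma card_nonunit_solutions_ge:
  assumes c: "c dvd 1"
  shows "h\<^sup>2 * card (unit_K n) \<le> card (nonunit_solutions (Suc n) c)"
proof -
  let ?f = "\<lambda>l. (hd l, K (tl l), tl (tl (tl l)))"
  have "Nonunits \<times> Nonunits \<times> unit_K n \<subseteq> ?f ` nonunit_solutions (Suc n) c"
  proof
    fix p assume "p \<in> Nonunits \<times> Nonunits \<times> unit_K n"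
    then obtain a y as where p: "p = (a, y, as)" "\<not> a dvd 1" "\<not> y dvd 1" "length as = n" "K as dvd 1"
      by (auto simp: unit_K_def)
    \<comment> \<open>The target \<open>a * y - c\<close> is a unit, so that \<open>b\<close> can
      then be solved for \<open>K (b # e # as) = y\<close>; the continuant of the whole list is
      \<open>a * y - (a * y - c)\<close>.\<close>
    obtain e where "e * K as + L as = a * y - c" using unit_linear_solve[OF p(5)] .
    then have e: "K (e # as) = a * y - c" by (simp add: M_Cons_entries)
    then have "K (e # as) dvd 1" using c p by (simp add: is_unit_diff_iff is_unit_mult_iff_comm_ring)
    then obtain b where "b * K (e # as) + L (e # as) = y" by (rule unit_linear_solve)
    then have b: "K (b # e # as) = y" by (simp only: M_Cons_entries(1)[of b])
    have "K (a # b # e # as) = c"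
      using b e unfolding M_Cons_entries(1)[of a] M_Cons_entries(2)[of b] by simp
    then have "a # b # e # as \<in> nonunit_solutions (Suc n) c"
      unfolding nonunit_solutions_def mem_Collect_eq using p b by (intro exI conjI refl) simp_all
    then show "p \<in> ?f ` nonunit_solutions (Suc n) c"
      by (rule rev_image_eqI) (use p b in simp)
  qed
  then have "card (Nonunits \<times> Nonunits \<times> unit_K n) \<le> card (nonunit_solutions (Suc n) c)"
    by (rule surj_card_le[rotated]) simp
  then show ?thesis by (simp add: card_cartesian_product h_def power2_eq_square)
qed

end

section \<open>The ring of integers modulo a power of two\<close>

text \<open>Bezout coefficients for an odd \<open>k\<close> and 2^m give an inverse; conversely, an
  inverse modulo 2^m is also one modulo 2.\<close>

lemma mod_ring_of_int_unit_iff: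
  assumes "CARD('b::nontriv) = 2 ^ m" "m \<ge> 1"
  shows "(of_int k :: 'b mod_ring) dvd 1 \<longleftrightarrow> odd k"
proof
  assume "odd k"
  then have "coprime k (2 ^ m)" by simp
  then obtain u v where "u * k + v * 2 ^ m = 1" by (metis bezout_int coprime_imp_gcd_eq_1)
  then have "of_int (u * k + v * 2 ^ m) = (1 :: 'b mod_ring)" by simp
  moreover have "of_int (2 ^ m) = (0 :: 'b mod_ring)"
    using of_nat_card_eq_0[where 'a='b] assms by simp
  ultimately have "of_int u * of_int k = (1 :: 'b mod_ring)"
    by (simp only: of_int_add of_int_mult) simp
  then show "(of_int k :: 'b mod_ring) dvd 1" by (metis dvd_triv_right)
next
  assume "(of_int k :: 'b mod_ring) dvd 1"
  then obtain y where y: "1 = of_int k * (y :: 'b mod_ring)" by (rule dvdE)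
  have "y = of_int (to_int_mod_ring y)" by (simp add: of_int_of_int_mod_ring)
  with y have "of_int (k * to_int_mod_ring y) = (of_int 1 :: 'b mod_ring)" by simp
  then have "(k * to_int_mod_ring y) mod 2 ^ m = 1 mod 2 ^ m"
    using assms by (simp only: of_int_of_int_mod_ring) (transfer, simp)
  then have "(k * to_int_mod_ring y) mod 2 = 1 mod 2"
    using assms(2) by (metis dvd_power mod_mod_cancel One_nat_def Suc_le_eq)
  then show "odd k" by (metis even_mult_iff odd_iff_mod_2_eq_one one_mod_two_eq_one)
qed

lemma binary_local_ring_mod_ring:
  assumes "CARD('b::nontriv) = 2 ^ m" "m \<ge> 1"
  shows "binary_local_ring TYPE('b mod_ring)"
proof
  fix x y :: "'b mod_ring"
  have "x = of_int (to_int_mod_ring x)" "y = of_int (to_int_mod_ring y)"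
    by (simp_all add: of_int_of_int_mod_ring)
  then obtain k l where "x = of_int k" "y = of_int l" by blast
  then show "x + y dvd 1 \<longleftrightarrow> (x dvd 1 \<longleftrightarrow> \<not> y dvd 1)"
    by (auto simp: mod_ring_of_int_unit_iff[OF assms] simp flip: of_int_add)
qed

section \<open>Exact count for odd lengths and bounds for even lengths\<close>

theorem theorem1p4:
  fixes m :: nat and \<epsilon> :: int
  assumes "m \<ge> 2" and "CARD('b::nontriv) = 2 ^ m" and "\<epsilon> \<in> {-1, 1}"
  shows "(\<forall>n::nat. n \<ge> 2 \<longrightarrow>
           card (\<Omega> 1 (2 * n + 1) :: 'b mod_ring list set)
             = card (\<Omega> (-1) (2 * n + 1) :: 'b mod_ring list set) \<and>
           real (card (\<Omega> (-1) (2 * n + 1) :: 'b mod_ring list set))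
             = 2 powi (2 * int m * int n - 2 * int n - 2 * int m - 1) * (2 ^ (2 * n + 3) - 8) / 3)
       \<and> (\<forall>n::nat. n \<ge> 3 \<longrightarrow>
           real (card (\<Omega> \<epsilon> (2 * n) :: 'b mod_ring list set))
             \<ge> D m (2 * n) + 2 ^ (m - 1) * D m (2 * n - 1) + real m * 2 ^ (m - 1) * D m (2 * n - 4) \<and>
           real (card (\<Omega> \<epsilon> (2 * n) :: 'b mod_ring list set))
             \<le> D m (2 * n) + 2 ^ (m - 1) * D m (2 * n - 1) + 2 ^ (2 * m - 2) * D m (2 * n - 1))"
proof -
  interpret binary_local_ring "TYPE('b mod_ring)"
    using assms by (intro binary_local_ring_mod_ring[of m]) auto
  have h: "h = 2 ^ (m - 1)"
    using card_ring assms(1,2) by (cases m) auto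
  \<comment> \<open>The exponent is (m - 1) k - 3, and its factor 1/8 cancels the 8 in 2^(k+4) + 8
    (-1)^(k+4).\<close>
  have D: "D m (k + 3) = real (card (unit_K k))" for k
  proof -
    have "int m * int (k + 3) - int (k + 3) - 3 * int m = int ((m - 1) * k) - 3"
      using assms(1) by (simp add: of_nat_diff algebra_simps)
    then have "(2::real) powi (int m * int (k + 3) - int (k + 3) - 3 * int m) = real h ^ k / 8"
      unfolding h by (simp only:) (simp add: power_int_diff power_mult del: of_nat_mult)
    then show ?thesis
      unfolding D_def card_unit_K by (simp only:) (simp add: power_add field_simps)
  qed
  \<comment> \<open>For n = 3 the lower bound involves \<open>D m 2\<close>, which lies below the
    range of the preceding identity.\<close>
  have D2: "D m 2 = 0" by (simp add: D_def)
  have odd_card: "h * card (\<Omega> \<delta> (2 * n + 1) :: 'b mod_ring list set) = card (unit_K (2 * n - 1))"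
    if "\<delta> \<in> {-1, 1}" "n \<ge> 2" for \<delta> :: int and n
  proof -
    have "2 * n + 1 = Suc (Suc (2 * n - 1))" using that by simp
    moreover have "(of_int (- \<delta>) :: 'b mod_ring) dvd 1" using that by auto
    ultimately show ?thesis
      using that by (simp only: card_\<Omega>_eq_card_K) (rule h_mult_card_K_odd_length, auto)
  qed
  show ?thesis
  proof (intro conjI allI impI)
    fix n :: nat assume n: "n \<ge> 2"
    show "card (\<Omega> 1 (2 * n + 1) :: 'b mod_ring list set) = card (\<Omega> (-1) (2 * n + 1) :: 'b mod_ring list set)"
      by (rule mult_left_cancel[THEN iffD1, of h]) (use odd_card[of 1 n] odd_card[of "-1" n] n h_pos in simp_all)
    have e: "2 * int m * int n - 2 * int n - 2 * int m - 1 = int ((m - 1) * (2 * n - 2)) - 3"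
      using assms(1) n by (cases m; cases n) (simp_all add: algebra_simps)
    have p: "(2::real) powi (2 * int m * int n - 2 * int n - 2 * int m - 1) = real h ^ (2 * n - 2) / 8"
      unfolding e h by (simp add: power_int_diff power_mult del: of_nat_mult)
    obtain k where k: "n = Suc k" using n by (cases n) auto
    \<comment> \<open>The length 2n - 1 is odd, whence the sign -1 in \<open>card_unit_K\<close>;
      one factor \<open>h\<close> is split off for cancellation.\<close>
    have "real h * real (card (\<Omega> (-1) (2 * n + 1) :: 'b mod_ring list set))
        = real h * (real h ^ (2 * n - 2) * (2 ^ (2 * n) - 1) / 3)"
      using arg_cong[OF odd_card[of "-1" n], of real] n card_unit_K[of "2 * n - 1"]
      by (simp add: k)
    then have "real (card (\<Omega> (-1) (2 * n + 1) :: 'b mod_ring list set))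
        = real h ^ (2 * n - 2) * (2 ^ (2 * n) - 1) / 3"
      by (rule mult_left_cancel[THEN iffD1, rotated]) (use h_pos in simp)
    then show "real (card (\<Omega> (-1) (2 * n + 1) :: 'b mod_ring list set))
        = 2 powi (2 * int m * int n - 2 * int n - 2 * int m - 1) * (2 ^ (2 * n + 3) - 8) / 3"
      unfolding p by (simp add: power_add field_simps)
  next
    fix n :: nat assume n: "n \<ge> 3"
    \<comment> \<open>The continuants have lists of length k + 4. Thus \<open>D m (2 * n)\<close>
      counts \<open>unit_K (k + 3)\<close>, \<open>D m (2 * n - 1)\<close> counts
      \<open>unit_K (k + 2)\<close>, and the nonunit case has tails of length k + 2.\<close>
    define k where "k = 2 * n - 6"
    have k: "2 * n = k + 6" "even k" using n by (simp_all add: k_def)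
    let ?c = "of_int (- \<epsilon>) :: 'b mod_ring"
    have c: "?c dvd 1" using assms(3) by auto
    have "card (\<Omega> \<epsilon> (2 * n) :: 'b mod_ring list set)
        = card {as :: 'b mod_ring list. length as = Suc (Suc (k + 2)) \<and> K as = ?c}"
      using card_\<Omega>_eq_card_K[OF assms(3), of "Suc (Suc (k + 2))", where 'a = "'b mod_ring"] k
      by (simp add: numeral_eq_Suc)
    then have \<Omega>: "real (card (\<Omega> \<epsilon> (2 * n) :: 'b mod_ring list set))
        = D m (2 * n) + 2 ^ (m - 1) * D m (2 * n - 1) + real (card (nonunit_solutions (k + 2) ?c))"
      using card_K_eq[OF c, of "k + 2"] D[of "k + 3"] D[of "k + 2"] k h
      by (simp add: numeral_eq_Suc)
    have hh: "(2::real) ^ (2 * m - 2) = (real h)\<^sup>2"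
      unfolding h by (simp add: diff_mult_distrib2 flip: power_mult)
    have "real (card (nonunit_solutions (k + 2) ?c)) \<le> (real h)\<^sup>2 * real (card (unit_K (k + 2)))"
      using card_nonunit_solutions_le[OF c, of "k + 2"] by (metis of_nat_le_iff of_nat_mult of_nat_power)
    also have "real (card (unit_K (k + 2))) = D m (2 * n - 1)"
      using D[of "k + 2"] k by (simp add: numeral_eq_Suc)
    finally show "real (card (\<Omega> \<epsilon> (2 * n) :: 'b mod_ring list set))
        \<le> D m (2 * n) + 2 ^ (m - 1) * D m (2 * n - 1) + 2 ^ (2 * m - 2) * D m (2 * n - 1)"
      unfolding \<Omega> hh by simp
    have m: "m \<le> h"
      unfolding h using less_exp[of "m - 1"] by linarith
    \<comment> \<open>For k > 0 the left side counts \<open>unit_K (k - 1)\<close>, so this compares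
      two lengths that differ by 2. With \<open>m \<le> h\<close>, the bound h^2
      \<open>card (unit_K (k + 1))\<close> then dominates the required term.\<close>
    have D_le: "D m (2 * n - 4) \<le> real (card (unit_K (k + 1)))"
    proof (cases "k = 0")
      case True
      then show ?thesis using k D2 by simp
    next
      case False
      then obtain j where j: "k = Suc j" by (cases k) auto
      then have "odd j" using k by simp
      \<comment> \<open>Both lengths are odd, so both closed forms carry the sign -1, and each
        factor grows.\<close>
      have "real h ^ j * (2 ^ (j + 1) - 1) \<le> real h ^ (j + 2) * (2 ^ (j + 3) - 1)"
        using h_pos one_le_power[of "2::real" "j + 1"]
        by (intro mult_mono power_increasing diff_right_mono) (auto simp: Suc_le_eq)
      then show ?thesis
        using D[of j] k j \<open>odd j\<close> card_unit_K[of j] card_unit_K[of "j + 2"]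
        by (simp add: numeral_eq_Suc)
    qed
    have "real m * 2 ^ (m - 1) * D m (2 * n - 4) \<le> real h * real h * real (card (unit_K (k + 1)))"
    proof -
      have "real m * 2 ^ (m - 1) * D m (2 * n - 4) \<le> real m * 2 ^ (m - 1) * real (card (unit_K (k + 1)))"
        using D_le by (rule mult_left_mono) simp
      also have "\<dots> \<le> real h * real h * real (card (unit_K (k + 1)))"
        using m h by (intro mult_mono) auto
      finally show ?thesis .
    qed
    also have "\<dots> \<le> real (card (nonunit_solutions (k + 2) ?c))"
      using card_nonunit_solutions_ge[OF c, of "k + 1"]
      by (simp add: power2_eq_square flip: of_nat_mult)
    finally show "D m (2 * n) + 2 ^ (m - 1) * D m (2 * n - 1) + real m * 2 ^ (m - 1) * D m (2 * n - 4)
        \<le> real (card (\<Omega> \<epsilon> (2 * n) :: 'b mod_ring list set))"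
      unfolding \<Omega> by simp
  qed
qed

end
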